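(* Let $\Omega_D$ be a connected open circular set in $\mathbb{H}$, let $f=\mathcal{I}(F):\Omega_D\to\mathbb{H}$ be a slice regular function, and let $V(f)=\{x\in\Omega_D \mid f(x)=0\}$ be its zero locus. If there exist $J,K\in\mathbb{S}$ with $K\neq J$ such that both $D_K^+\cap V(f)$ and $D_J^+\cap V(f)$ contain accumulation points (that is, each of these two sets contains a point which is an accumulation point of that set), then $f\equiv 0$ on $\Omega_D$.
   Context: $\mathbb{H}$ is the algebra of quaternions and $\mathbb{S}=\{x\in\mathbb{H}\mid x^2=-1\}$. For $J\in\mathbb{S}$: $\mathbb{C}_J=\{\alpha+\beta J\mid\alpha,\beta\in\mathbb{R}\}$ and $\mathbb{C}_J^+=\{\alpha+\beta J\mid \alpha,\beta\in\mathbb{R},\ \beta\ge 0\}$. $\mathbb{H}_{\mathbb{C}}=\mathbb{H}\otimes_{\mathbb{R}}\mathbb{C}$, with elements $w=x+\sqrt{-1}\,y$ ($x,y\in\mathbb{H}$, $\sqrt{-1}$ central) and conjugation $\overline{x+\sqrt{-1}y}=x-\sqrt{-1}y$. $D\subset\mathbb{C}$ is an open set, symmetric with respect to the real axis (by convention). The circular set associated with $D$ is $\Omega_D=\{\alpha+\beta J\mid \alpha,\beta\in\mathbb{R},\ \alpha+i\beta\in D,\ J\in\mathbb{S}\}$ (it may or may not meet $\mathbb{R}$), and $D_J^+=\Omega_D\cap\mathbb{C}_J^+$. A stem function on $D$ is a function $F=F_1+\sqrt{-1}F_2:D\to\mathbb{H}_{\mathbb{C}}$ ($F_1,F_2$ being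 $\mathbb{H}$-valued) with $F(\overline z)=\overline{F(z)}$ for all $z\in D$. It induces the slice function $f=\mathcal{I}(F):\Omega_D\to\mathbb{H}$, $f(\alpha+\beta J)=F_1(z)+JF_2(z)$, $z=\alpha+\sqrt{-1}\beta$. The function $f=\mathcal{I}(F)$ is slice regular if $F$ is of class $C^1$ and holomorphic with respect to the complex structure on $\mathbb{H}_{\mathbb{C}}$ given by left multiplication by $\sqrt{-1}$, i.e. $\frac{\partial F}{\partial\overline z}=\frac12\left(\frac{\partial F}{\partial\alpha}+\sqrt{-1}\frac{\partial F}{\partial\beta}\right)=0$ on $D$. *)

theory Defs
  imports "HOL-Analysis.Analysis"
begin

section \<open>The algebra of quaternions\<close>

datatype quat = Quat (qre: real) (qi: real) (qj: real) (qk: real)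

lemma quat_eq_iff:
  "x = y \<longleftrightarrow> qre x = qre y \<and> qi x = qi y \<and> qj x = qj y \<and> qk x = qk y"
  by (cases x; cases y) auto

instantiation quat :: ring_1
begin

definition "0 = Quat 0 0 0 0"
definition "1 = Quat 1 0 0 0"
definition "x + y = Quat (qre x + qre y) (qi x + qi y) (qj x + qj y) (qk x + qk y)"
definition "- x = Quat (- qre x) (- qi x) (- qj x) (- qk x)"
definition "x - y = Quat (qre x - qre y) (qi x - qi y) (qj x - qj y) (qk x - qk y)"
definition "x * y = Quat
   (qre x * qre y - qi x * qi y - qj x * qj y - qk x * qk y)
   (qre x * qi y + qi x * qre y + qj x * qk y - qk x * qj y)
   (qre x * qj y - qi x * qk y + qj x * qre y + qk x * qi y)
   (qre x * qk y + qi x * qj y - qj x * qi y + qk x * qre y)"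

instance
  by standard
    (auto simp: quat_eq_iff zero_quat_def one_quat_def plus_quat_def uminus_quat_def
      minus_quat_def times_quat_def algebra_simps)

end

lemma quat_sel_simps [simp]:
  "qre 0 = 0" "qi 0 = 0" "qj 0 = 0" "qk 0 = 0"
  "qre 1 = 1" "qi 1 = 0" "qj 1 = 0" "qk 1 = 0"
  "qre (x + y) = qre x + qre y" "qi (x + y) = qi x + qi y"
  "qj (x + y) = qj x + qj y" "qk (x + y) = qk x + qk y"
  "qre (- x) = - qre x" "qi (- x) = - qi x" "qj (- x) = - qj x" "qk (- x) = - qk x"
  "qre (x - y) = qre x - qre y" "qi (x - y) = qi x - qi y"
  "qj (x - y) = qj x - qj y" "qk (x - y) = qk x - qk y"
  by (simp_all add: zero_quat_def one_quat_def plus_quat_def uminus_quat_def minus_quat_def)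

lemma quat_mult_sel:
  "qre (x * y) = qre x * qre y - qi x * qi y - qj x * qj y - qk x * qk y"
  "qi (x * y) = qre x * qi y + qi x * qre y + qj x * qk y - qk x * qj y"
  "qj (x * y) = qre x * qj y - qi x * qk y + qj x * qre y + qk x * qi y"
  "qk (x * y) = qre x * qk y + qi x * qj y - qj x * qi y + qk x * qre y"
  by (simp_all add: times_quat_def)

instantiation quat :: real_algebra_1
begin

definition "r *\<^sub>R x = Quat (r * qre x) (r * qi x) (r * qj x) (r * qk x)"

instance
  by standard (auto simp: quat_eq_iff scaleR_quat_def quat_mult_sel algebra_simps)

end

lemma quat_scaleR_sel [simp]:
  "qre (r *\<^sub>R x) = r * qre x" "qi (r *\<^sub>R x) = r * qi x"
  "qj (r *\<^sub>R x) = r * qj x" "qk (r *\<^sub>R x) = r * qk x"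
  by (simp_all add: scaleR_quat_def)

lemma quat_of_real_sel [simp]:
  "qre (of_real r) = r" "qi (of_real r) = 0" "qj (of_real r) = 0" "qk (of_real r) = 0"
  by (simp_all add: of_real_def)

instantiation quat :: real_inner
begin

definition "inner x y = qre x * qre y + qi x * qi y + qj x * qj y + qk x * qk y"
definition "norm (x::quat) = sqrt (inner x x)"
definition "sgn (x::quat) = x /\<^sub>R norm x"
definition "dist (x::quat) y = norm (x - y)"
definition "(uniformity :: (quat \<times> quat) filter) =
  (INF e\<in>{0<..}. principal {(x, y). dist x y < e})"
definition "open (U :: quat set) \<longleftrightarrow>
  (\<forall>x\<in>U. eventually (\<lambda>(x', y). x' = x \<longrightarrow> y \<in> U) uniformity)"

instance
proof
  fix x y z :: quat and r :: real and U :: "quat set"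
  show "dist x y = norm (x - y)" by (rule dist_quat_def)
  show "sgn x = x /\<^sub>R norm x" by (rule sgn_quat_def)
  show "uniformity = (INF e\<in>{0<..}. principal {(x::quat, y). dist x y < e})"
    by (rule uniformity_quat_def)
  show "open U \<longleftrightarrow> (\<forall>x\<in>U. eventually (\<lambda>(x', y). x' = x \<longrightarrow> y \<in> U) uniformity)"
    by (rule open_quat_def)
  show "inner x y = inner y x" by (simp add: inner_quat_def mult.commute)
  show "inner (x + y) z = inner x z + inner y z" by (simp add: inner_quat_def algebra_simps)
  show "inner (r *\<^sub>R x) y = r * inner x y" by (simp add: inner_quat_def algebra_simps)
  show "0 \<le> inner x x" by (simp add: inner_quat_def)
  show "inner x x = 0 \<longleftrightarrow> x = 0"
  proof
    assume "inner x x = 0"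
    then have s: "(qre x)\<^sup>2 + (qi x)\<^sup>2 + (qj x)\<^sup>2 + (qk x)\<^sup>2 = 0"
      by (simp add: inner_quat_def power2_eq_square)
    have "(qre x)\<^sup>2 \<ge> 0" "(qi x)\<^sup>2 \<ge> 0" "(qj x)\<^sup>2 \<ge> 0" "(qk x)\<^sup>2 \<ge> 0" by simp_all
    then have "(qre x)\<^sup>2 = 0" "(qi x)\<^sup>2 = 0" "(qj x)\<^sup>2 = 0" "(qk x)\<^sup>2 = 0"
      using s by linarith+
    then show "x = 0" by (simp add: quat_eq_iff)
  qed (simp add: inner_quat_def)
  show "norm x = sqrt (inner x x)" by (rule norm_quat_def)
qed

end

instantiation quat :: real_normed_div_algebra
begin

definition "inverse x = Quat (qre x) (- qi x) (- qj x) (- qk x) /\<^sub>R (norm x)\<^sup>2"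
definition "x div (y::quat) = x * inverse y"

instance
proof
  fix x y :: quat
  have n2: "(norm z)\<^sup>2 = qre z * qre z + qi z * qi z + qj z * qj z + qk z * qk z" for z :: quat
    by (simp add: power2_norm_eq_inner inner_quat_def)
  show "norm (x * y) = norm x * norm y"
    unfolding norm_quat_def real_sqrt_mult [symmetric] inner_quat_def quat_mult_sel
    by (rule arg_cong [where f = sqrt]) algebra
  define N where "N = (norm x)\<^sup>2"
  have inv: "qre (inverse x) = qre x / N" "qi (inverse x) = - qi x / N"
      "qj (inverse x) = - qj x / N" "qk (inverse x) = - qk x / N"
    by (simp_all add: inverse_quat_def N_def divide_inverse mult.commute)
  have N: "N = qre x * qre x + qi x * qi x + qj x * qj x + qk x * qk x"
    by (simp add: N_def n2)
  {
    assume "x \<noteq> 0"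
    then have N0: "N \<noteq> 0" by (simp add: N_def)
    have *: "qre x * qre x / N + qi x * qi x / N + qj x * qj x / N + qk x * qk x / N = 1"
      using N0 N by (simp flip: add_divide_distrib)
    show "inverse x * x = 1" "x * inverse x = 1"
      using * by (simp_all add: quat_eq_iff quat_mult_sel inv mult.commute)
  }
  show "x div y = x * inverse y" by (rule divide_quat_def)
  show "inverse (0::quat) = 0" by (simp add: inverse_quat_def quat_eq_iff)
qed

end


section \<open>Complexified quaternions\<close>

text \<open>The pair \<open>(x, y)\<close> stands for \<open>x + \<surd>-1 y\<close> in the tensor product of the quaternions with the
  complex numbers over the reals; its real vector space structure and topology are those of
  the product type.\<close>

type_synonym cquat = "quat \<times> quat"

definition cquat_cnj :: "cquat \<Rightarrow> cquat" where
  "cquat_cnj w = (fst w, - snd w)"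

text \<open>Left multiplication by the central element \<open>\<surd>-1\<close>: \<open>\<surd>-1 (x + \<surd>-1 y) = -y + \<surd>-1 x\<close>.\<close>

definition cquat_imult :: "cquat \<Rightarrow> cquat" where
  "cquat_imult w = (- snd w, fst w)"


section \<open>Imaginary units, slices and circular sets\<close>

definition imag_units :: "quat set" where
  "imag_units = {x. x\<^sup>2 = -1}"

definition slice_point :: "complex \<Rightarrow> quat \<Rightarrow> quat" where
  "slice_point z J = of_real (Re z) + of_real (Im z) * J"

definition half_slice :: "quat \<Rightarrow> quat set" where
  "half_slice J = {slice_point z J | z. Im z \<ge> 0}"

definition circular_set :: "complex set \<Rightarrow> quat set" where
  "circular_set D = {slice_point z J | z J. z \<in> D \<and> J \<in> imag_units}"

definition half_slice_part :: "complex set \<Rightarrow> quat \<Rightarrow> quat set" where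
  "half_slice_part D J = circular_set D \<inter> half_slice J"


section \<open>Stem functions and slice regular functions\<close>

definition stem_function :: "complex set \<Rightarrow> (complex \<Rightarrow> cquat) \<Rightarrow> bool" where
  "stem_function D F \<longleftrightarrow> (\<forall>z\<in>D. F (cnj z) = cquat_cnj (F z))"

text \<open>Every point of the circular set has several representations \<open>\<alpha> + \<beta> J\<close>; that they all give the
  same value when \<open>F\<close> is a stem function is \<open>induced_slice_eq\<close> below. Outside the circular
  set of \<open>D\<close> the value is unspecified.\<close>

definition induced_slice :: "complex set \<Rightarrow> (complex \<Rightarrow> cquat) \<Rightarrow> quat \<Rightarrow> quat" where
  "induced_slice D F x =
     (THE y. \<exists>z\<in>D. \<exists>J\<in>imag_units. x = slice_point z J \<and> y = fst (F z) + J * snd (F z))"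

lemma imag_units_iff:
  "J \<in> imag_units \<longleftrightarrow> qre J = 0 \<and> qi J * qi J + qj J * qj J + qk J * qk J = 1"
proof
  assume "J \<in> imag_units"
  then have "J * J = -1" by (simp add: imag_units_def power2_eq_square)
  then have e: "qre J * qre J - qi J * qi J - qj J * qj J - qk J * qk J = -1"
      "2 * (qre J * qi J) = 0" "2 * (qre J * qj J) = 0" "2 * (qre J * qk J) = 0"
    by (auto simp: quat_eq_iff quat_mult_sel)
  have "qre J = 0"
  proof (rule ccontr)
    assume "qre J \<noteq> 0"
    with e have "qi J = 0" "qj J = 0" "qk J = 0" by simp_all
    with e(1) have "qre J * qre J = -1" by simp
    then show False using zero_le_square [of "qre J"] by linarith
  qed
  then show "qre J = 0 \<and> qi J * qi J + qj J * qj J + qk J * qk J = 1"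
    using e(1) by simp
next
  assume "qre J = 0 \<and> qi J * qi J + qj J * qj J + qk J * qk J = 1"
  then have "J * J = -1" by (auto simp: quat_eq_iff quat_mult_sel)
  then show "J \<in> imag_units" by (simp add: imag_units_def power2_eq_square)
qed

lemma slice_point_sel [simp]:
  assumes "J \<in> imag_units"
  shows "qre (slice_point z J) = Re z" "qi (slice_point z J) = Im z * qi J"
    "qj (slice_point z J) = Im z * qj J" "qk (slice_point z J) = Im z * qk J"
  using assms by (simp_all add: slice_point_def quat_mult_sel imag_units_iff)

lemma slice_point_eqD:
  assumes J: "J \<in> imag_units" and K: "K \<in> imag_units"
    and eq: "slice_point z J = slice_point w K"
  shows "w = z \<and> K = J \<or> w = cnj z \<and> K = - J \<or> w = z \<and> Im z = 0"
proof -
  have re: "Re z = Re w"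
    using arg_cong [OF eq, of qre] J K by simp
  have im: "Im z * qi J = Im w * qi K" "Im z * qj J = Im w * qj K" "Im z * qk J = Im w * qk K"
    using arg_cong [OF eq, of qi] arg_cong [OF eq, of qj] arg_cong [OF eq, of qk] J K by simp_all
  have J1: "qre J = 0" "qi J * qi J + qj J * qj J + qk J * qk J = 1"
    and K1: "qre K = 0" "qi K * qi K + qj K * qj K + qk K * qk K = 1"
    using J K by (auto simp: imag_units_iff)
  have "(Im z)\<^sup>2 = (Im z)\<^sup>2 * (qi J * qi J + qj J * qj J + qk J * qk J)"
    using J1 by simp
  also have "\<dots> = (Im z * qi J)\<^sup>2 + (Im z * qj J)\<^sup>2 + (Im z * qk J)\<^sup>2"
    by (simp add: power2_eq_square algebra_simps)
  also have "\<dots> = (Im w)\<^sup>2 * (qi K * qi K + qj K * qj K + qk K * qk K)"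
    unfolding im by (simp add: power2_eq_square algebra_simps)
  finally have "(Im z)\<^sup>2 = (Im w)\<^sup>2" using K1 by simp
  then consider "Im w = Im z" | "Im w = - Im z" by (auto simp: power2_eq_iff)
  then show ?thesis
  proof cases
    case 1
    then have "w = z" using re by (simp add: complex_eq_iff)
    moreover have "K = J" if "Im z \<noteq> 0"
      using that 1 im J1 K1 by (auto simp: quat_eq_iff)
    ultimately show ?thesis by blast
  next
    case 2
    then have w: "w = cnj z" using re by (simp add: complex_eq_iff)
    show ?thesis
    proof (cases "Im z = 0")
      case True
      then show ?thesis using 2 re by (simp add: complex_eq_iff)
    next
      case False
      have "Im z * (qi K + qi J) = 0" "Im z * (qj K + qj J) = 0" "Im z * (qk K + qk J) = 0"
        using im 2 by (simp_all add: algebra_simps)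
      then have "qi K + qi J = 0" "qj K + qj J = 0" "qk K + qk J = 0" using False by simp_all
      then have "K = - J" using J1 K1 by (simp add: quat_eq_iff)
      then show ?thesis using w by blast
    qed
  qed
qed

lemma induced_slice_eq:
  assumes F: "stem_function D F" and z: "z \<in> D" and J: "J \<in> imag_units"
  shows "induced_slice D F (slice_point z J) = fst (F z) + J * snd (F z)"
  unfolding induced_slice_def
proof (rule the_equality)
  show "\<exists>w\<in>D. \<exists>K\<in>imag_units. slice_point z J = slice_point w K \<and>
      fst (F z) + J * snd (F z) = fst (F w) + K * snd (F w)"
    using z J by blast
next
  fix y
  assume "\<exists>w\<in>D. \<exists>K\<in>imag_units. slice_point z J = slice_point w K \<and> y = fst (F w) + K * snd (F w)"
  then obtain w K where K: "K \<in> imag_units" and eq: "slice_point z J = slice_point w K"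
    and y: "y = fst (F w) + K * snd (F w)" by blast
  have cnj: "F (cnj z) = (fst (F z), - snd (F z))"
    using F z by (simp add: stem_function_def cquat_cnj_def)
  from slice_point_eqD [OF J K eq] consider
    "w = z" "K = J" | "w = cnj z" "K = - J" | "w = z" "Im z = 0" by blast
  then show "y = fst (F z) + J * snd (F z)"
  proof cases
    case 1 then show ?thesis using y by simp
  next
    case 2 then show ?thesis using y cnj by simp
  next
    case 3
    then have "cnj z = z" by (simp add: complex_eq_iff)
    then have "snd (F z) = - snd (F z)" using cnj by (metis snd_conv)
    then have "snd (F z) = 0" by (simp add: quat_eq_iff)
    then show ?thesis using y 3 by simp
  qed
qed

definition partial_re :: "(complex \<Rightarrow> cquat) \<Rightarrow> complex \<Rightarrow> cquat" where
  "partial_re F z = vector_derivative (\<lambda>t. F (Complex t (Im z))) (at (Re z))"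

definition partial_im :: "(complex \<Rightarrow> cquat) \<Rightarrow> complex \<Rightarrow> cquat" where
  "partial_im F z = vector_derivative (\<lambda>t. F (Complex (Re z) t)) (at (Im z))"

definition C1_stem :: "complex set \<Rightarrow> (complex \<Rightarrow> cquat) \<Rightarrow> bool" where
  "C1_stem D F \<longleftrightarrow>
     (\<forall>z\<in>D. (\<lambda>t. F (Complex t (Im z))) differentiable (at (Re z)) \<and>
            (\<lambda>t. F (Complex (Re z) t)) differentiable (at (Im z))) \<and>
     continuous_on D (partial_re F) \<and> continuous_on D (partial_im F)"

definition dbar :: "(complex \<Rightarrow> cquat) \<Rightarrow> complex \<Rightarrow> cquat" where
  "dbar F z = (1/2) *\<^sub>R (partial_re F z + cquat_imult (partial_im F z))"

definition slice_regular :: "complex set \<Rightarrow> (quat \<Rightarrow> quat) \<Rightarrow> bool" where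
  "slice_regular D f \<longleftrightarrow>
     (\<exists>F. stem_function D F \<and> C1_stem D F \<and> (\<forall>z\<in>D. dbar F z = 0) \<and>
          (\<forall>x\<in>circular_set D. f x = induced_slice D F x))"

definition zero_locus :: "complex set \<Rightarrow> (quat \<Rightarrow> quat) \<Rightarrow> quat set" where
  "zero_locus D f = {x \<in> circular_set D. f x = 0}"

end

(* For an imaginary unit J the function F1 + J F2 intertwines the complex structure of the
   stem function with left multiplication by J, so its complex coordinates with respect to J are
   holomorphic and the identity theorem applies to them on an open connected set containing
   the closed upper half of D. Two different units give F1 + J F2 = F1 + K F2 = 0, whence
   (J - K) F2 = 0 and F1 = F2 = 0. *)
theory Submission
  imports Defs "HOL-Complex_Analysis.Complex_Analysis"
begin

section \<open>Complex coordinates with respect to an imaginary unit\<close>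

text \<open>Left multiplication by an imaginary unit \<open>J\<close> makes the quaternions a
  complex vector space; this is the Hermitian product of \<open>q\<close> with \<open>m\<close>
  there. The sign of the second term makes \<open>J\<close> act as \<open>\<i>\<close> in the
  argument \<open>q\<close>.\<close>

definition unit_coord :: "quat \<Rightarrow> quat \<Rightarrow> quat \<Rightarrow> complex" where
  "unit_coord J m q = of_real (inner q m) + \<i> * of_real (inner q (J * m))"

lemma bounded_linear_unit_coord: "bounded_linear (unit_coord J m)"
  unfolding unit_coord_def
  by (intro bounded_linear_add bounded_linear_const_mult
      bounded_linear_compose [OF bounded_linear_of_real] bounded_linear_inner_left)

text \<open>The adjoint of left multiplication by a quaternion is left multiplication by its
  conjugate, and the conjugate of an imaginary unit \<open>J\<close> is \<open>- J\<close>.\<close>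

lemma inner_imag_unit_mult_left:
  assumes "J \<in> imag_units"
  shows "inner (J * x) y = - inner x (J * y)"
  using assms by (simp add: imag_units_iff inner_quat_def quat_mult_sel algebra_simps)

lemma imag_unit_mult_mult:
  assumes "J \<in> imag_units"
  shows "J * (J * x) = - x"
proof -
  have "J * J = - 1" using assms by (simp add: imag_units_def power2_eq_square)
  then show ?thesis by (metis mult.assoc mult_minus1)
qed

lemma unit_coord_mult:
  assumes "J \<in> imag_units"
  shows "unit_coord J m (J * q) = \<i> * unit_coord J m q"
  using assms by (simp add: unit_coord_def inner_imag_unit_mult_left imag_unit_mult_mult
      complex_eq_iff)

text \<open>The real part is the squared norm of \<open>q\<close>. Taking \<open>m = q\<close> thus
  detects vanishing without a choice of basis.\<close>

lemma unit_coord_self_eq_0D: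
  assumes "unit_coord J q q = 0"
  shows "q = 0"
proof -
  have "Re (unit_coord J q q) = 0" using assms by simp
  then show ?thesis by (simp add: unit_coord_def)
qed

section \<open>The identity theorem on a slice\<close>

text \<open>Partial derivatives, one of them continuous, give a total real derivative; the
  Cauchy-Riemann equation makes it complex linear.\<close>

lemma holomorphic_on_if_partials:
  fixes h hx hy :: "complex \<Rightarrow> complex"
  assumes "open D"
    and hx: "\<And>z. z \<in> D \<Longrightarrow> ((\<lambda>t. h (Complex t (Im z))) has_vector_derivative hx z) (at (Re z))"
    and hy: "\<And>z. z \<in> D \<Longrightarrow> ((\<lambda>t. h (Complex (Re z) t)) has_vector_derivative hy z) (at (Im z))"
    and cont: "continuous_on D hy"
    and CR: "\<And>z. z \<in> D \<Longrightarrow> hx z + \<i> * hy z = 0"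
  shows "h holomorphic_on D"
proof -
  have "h field_differentiable (at z)" if z: "z \<in> D" for z
  proof -
    obtain e where e: "e > 0" "ball z e \<subseteq> D"
      using \<open>open D\<close> z open_contains_ball by blast
    \<comment> \<open>Radius \<open>e/2\<close> on each axis keeps the box inside
      \<open>ball z e\<close>, by the bound of the modulus by the sum of its coordinates.\<close>
    define X where "X = ball (Re z) (e/2)"
    define Y where "Y = ball (Im z) (e/2)"
    have inD: "Complex x y \<in> D" if "x \<in> X" "y \<in> Y" for x y
    proof -
      have "dist z (Complex x y) \<le> \<bar>Re (z - Complex x y)\<bar> + \<bar>Im (z - Complex x y)\<bar>"
        unfolding dist_norm by (rule cmod_le)
      also have "\<dots> < e" using that by (simp add: X_def Y_def dist_real_def)
      finally show ?thesis using e by auto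
    qed
    have XY: "Re z \<in> X" "Im z \<in> Y" using e by (auto simp: X_def Y_def)
    have "continuous_on (X \<times> Y) (\<lambda>p. Complex (fst p) (snd p))"
      unfolding Complex_eq by (intro continuous_intros)
    then have "continuous_on (X \<times> Y) (\<lambda>p. hy (Complex (fst p) (snd p)))"
      by (rule continuous_on_compose2 [OF cont]) (auto intro: inD)
    \<comment> \<open>The criterion for total differentiability wants the second partial derivative
      as a continuous map into bounded linear maps.\<close>
    then have blin: "continuous_on (X \<times> Y) (\<lambda>(x, y). blinfun_scaleR_left (hy (Complex x y)))"
      unfolding case_prod_unfold
      by (rule bounded_linear.continuous_on [OF bounded_linear_blinfun_scaleR_left])
    have "((\<lambda>(x, y). h (Complex x y)) has_derivative
        (\<lambda>(tx, ty). tx *\<^sub>R hx z + blinfun_scaleR_left (hy (Complex (Re z) (Im z))) ty))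
        (at (Re z, Im z) within X \<times> Y)"
    proof (rule has_derivative_partialsI)
      show "((\<lambda>x. h (Complex x (Im z))) has_derivative (\<lambda>tx. tx *\<^sub>R hx z)) (at (Re z) within X)"
        using hx [OF z] by (simp add: has_vector_derivative_def has_derivative_at_withinI)
      show "((\<lambda>y. h (Complex x y)) has_derivative
          blinfun_apply (blinfun_scaleR_left (hy (Complex x y)))) (at y within Y)"
        if "x \<in> X" "y \<in> Y" for x y
        using hy [OF inD [OF that]]
        by (simp add: has_vector_derivative_def has_derivative_at_withinI)
      show "continuous (at (Re z, Im z) within X \<times> Y)
          (\<lambda>(x, y). blinfun_scaleR_left (hy (Complex x y)))"
        using blin XY by (auto simp: continuous_on_eq_continuous_within)
    qed (use XY in \<open>auto simp: Y_def\<close>)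
    moreover have "at (Re z, Im z) within X \<times> Y = at (Re z, Im z)"
      using XY by (intro at_within_open open_Times) (auto simp: X_def Y_def)
    ultimately have der: "((\<lambda>(x, y). h (Complex x y)) has_derivative
        (\<lambda>(tx, ty). tx *\<^sub>R hx z + ty *\<^sub>R hy z)) (at (Re z, Im z))"
      by simp
    have "((\<lambda>w. (Re w, Im w)) has_derivative (\<lambda>w. (Re w, Im w))) (at z)"
      by (intro derivative_intros bounded_linear_imp_has_derivative bounded_linear_Re
          bounded_linear_Im)
    from has_derivative_compose [OF this der]
    have "(h has_derivative (\<lambda>w. Re w *\<^sub>R hx z + Im w *\<^sub>R hy z)) (at z)"
      by simp
    \<comment> \<open>By Cauchy-Riemann \<open>hy z = \<i> * hx z\<close>, so the real derivative is
      multiplication by \<open>hx z\<close>.\<close>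
    moreover have "Re w *\<^sub>R hx z + Im w *\<^sub>R hy z = hx z * w" for w
    proof -
      have "hy z = \<i> * hx z"
        using CR [OF z] by (simp add: complex_eq_iff)
      then show ?thesis
        by (simp add: complex_eq_iff algebra_simps)
    qed
    ultimately show ?thesis
      by (auto simp: field_differentiable_def has_field_derivative_def)
  qed
  then show ?thesis
    by (simp add: holomorphic_on_def field_differentiable_at_within)
qed

lemma holomorphic_on_unit_coord_stem:
  assumes J: "J \<in> imag_units" and D: "open D" and C1: "C1_stem D F"
    and dbar: "\<forall>z\<in>D. dbar F z = 0"
  shows "(\<lambda>z. unit_coord J m (fst (F z) + J * snd (F z))) holomorphic_on D"
proof -
  \<comment> \<open>This real linear form turns \<open>cquat_imult\<close> into multiplication by
    \<open>\<i>\<close>. Being bounded, it commutes with partial derivatives, so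
    \<open>dbar F z = 0\<close> becomes the scalar Cauchy-Riemann equation.\<close>
  define \<Lambda> :: "cquat \<Rightarrow> complex" where "\<Lambda> w = unit_coord J m (fst w + J * snd w)" for w
  interpret \<Lambda>: bounded_linear \<Lambda>
    unfolding \<Lambda>_def
    by (intro bounded_linear_compose [OF bounded_linear_unit_coord] bounded_linear_add
        bounded_linear_fst bounded_linear_compose [OF bounded_linear_mult_right]
        bounded_linear_snd)
  have \<Lambda>_imult: "\<Lambda> (cquat_imult w) = \<i> * \<Lambda> w" for w
  proof -
    have "- snd w + J * fst w = J * (fst w + J * snd w)"
      using J by (simp add: distrib_left imag_unit_mult_mult)
    then show ?thesis
      using J by (simp add: \<Lambda>_def cquat_imult_def unit_coord_mult)
  qed
  have "(\<lambda>z. \<Lambda> (F z)) holomorphic_on D"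
  proof (rule holomorphic_on_if_partials [OF D])
    fix z assume z: "z \<in> D"
    show "((\<lambda>t. \<Lambda> (F (Complex t (Im z)))) has_vector_derivative \<Lambda> (partial_re F z)) (at (Re z))"
      using C1 z unfolding C1_stem_def partial_re_def
      by (intro \<Lambda>.has_vector_derivative) (simp add: vector_derivative_works [symmetric])
    show "((\<lambda>t. \<Lambda> (F (Complex (Re z) t))) has_vector_derivative \<Lambda> (partial_im F z)) (at (Im z))"
      using C1 z unfolding C1_stem_def partial_im_def
      by (intro \<Lambda>.has_vector_derivative) (simp add: vector_derivative_works [symmetric])
    have "partial_re F z + cquat_imult (partial_im F z) = 0"
      using dbar z by (simp add: dbar_def)
    then have "\<Lambda> (partial_re F z + cquat_imult (partial_im F z)) = 0"
      by (simp add: \<Lambda>.zero)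
    then show "\<Lambda> (partial_re F z) + \<i> * \<Lambda> (partial_im F z) = 0"
      by (simp add: \<Lambda>.add \<Lambda>_imult)
  next
    show "continuous_on D (\<lambda>z. \<Lambda> (partial_im F z))"
      using C1 by (simp add: C1_stem_def \<Lambda>.continuous_on)
  qed
  then show ?thesis by (simp add: \<Lambda>_def)
qed

lemma stem_identity_theorem:
  assumes J: "J \<in> imag_units" and "open D" "C1_stem D F" "\<forall>z\<in>D. dbar F z = 0"
    and S: "S \<subseteq> D" "open S" "connected S"
    and p: "p \<in> S" "p islimpt {z \<in> S. fst (F z) + J * snd (F z) = 0}"
    and z: "z \<in> S"
  shows "fst (F z) + J * snd (F z) = 0"
proof (rule unit_coord_self_eq_0D)
  let ?g = "\<lambda>z. fst (F z) + J * snd (F z)"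
  \<comment> \<open>The identity theorem needs a fixed direction \<open>m\<close>; only afterwards
    is \<open>m\<close> set to the value of \<open>?g\<close> at the given point.\<close>
  have "unit_coord J m (?g z) = 0" for m
  proof (rule analytic_continuation [OF _ \<open>open S\<close> \<open>connected S\<close> _ p _ z])
    show "(\<lambda>z. unit_coord J m (?g z)) holomorphic_on S"
      using holomorphic_on_unit_coord_stem [OF assms(1-4)] S(1) by (rule holomorphic_on_subset)
  qed (auto simp: unit_coord_def)
  then show "unit_coord J (?g z) (?g z) = 0" .
qed

section \<open>Projection of a circular set to the closed upper half plane\<close>

text \<open>Forgets the imaginary unit: \<alpha> + \<beta> J goes to \<alpha> + i |\<beta>|. Using
  the norm of the imaginary part gives a formula that is continuous on all quaternions, the real
  axis included.\<close>

definition upper_proj :: "quat \<Rightarrow> complex" where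
  "upper_proj x = Complex (qre x) (norm (x - of_real (qre x)))"

lemma continuous_on_upper_proj: "continuous_on A upper_proj"
proof -
  have "qre = (\<lambda>x. inner x 1)" by (auto simp: inner_quat_def)
  moreover have "continuous_on A (\<lambda>x. inner x (1 :: quat))" by (intro continuous_intros)
  ultimately have "continuous_on A qre" by (simp only:)
  then show ?thesis
    unfolding upper_proj_def [abs_def] Complex_eq by (intro continuous_intros)
qed

lemma norm_imag_unit:
  assumes "J \<in> imag_units"
  shows "norm J = 1"
  using assms by (simp add: norm_quat_def inner_quat_def imag_units_iff)

lemma upper_proj_slice_point:
  assumes "J \<in> imag_units"
  shows "upper_proj (slice_point z J) = Complex (Re z) \<bar>Im z\<bar>"
proof -
  have "slice_point z J - of_real (Re z) = of_real (Im z) * J"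
    by (simp add: slice_point_def)
  then show ?thesis
    using assms by (simp add: upper_proj_def norm_mult norm_imag_unit)
qed

lemma slice_point_cnj: "slice_point (cnj z) (- J) = slice_point z J"
  by (simp add: slice_point_def)

lemma uminus_imag_units: "J \<in> imag_units \<Longrightarrow> - J \<in> imag_units"
  by (simp add: imag_units_def)

text \<open>Two parameters of the same quaternion are equal or conjugate, and \<open>D\<close> is
  closed under conjugation.\<close>

lemma slice_point_in_circular_set_iff:
  assumes "\<forall>z\<in>D. cnj z \<in> D" and "J \<in> imag_units"
  shows "slice_point z J \<in> circular_set D \<longleftrightarrow> z \<in> D"
proof
  assume "slice_point z J \<in> circular_set D"
  then obtain w K where "w \<in> D" "K \<in> imag_units" "slice_point z J = slice_point w K"
    by (auto simp: circular_set_def)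
  with slice_point_eqD [OF assms(2), of K z w] have "w \<in> D" "w = z \<or> w = cnj z"
    by auto
  then show "z \<in> D" using assms(1) by (metis complex_cnj_cnj)
qed (use assms in \<open>auto simp: circular_set_def\<close>)

lemma circular_set_upper_cases:
  assumes "\<forall>z\<in>D. cnj z \<in> D" and "x \<in> circular_set D"
  obtains z J where "z \<in> D" "Im z \<ge> 0" "J \<in> imag_units" "x = slice_point z J"
proof -
  obtain z J where z: "z \<in> D" "J \<in> imag_units" "x = slice_point z J"
    using assms(2) by (auto simp: circular_set_def)
  show ?thesis
  proof (cases "Im z \<ge> 0")
    case True
    then show ?thesis using that z by blast
  next
    case False
    then show ?thesis
      using that [of "cnj z" "- J"] z assms(1) by (simp add: slice_point_cnj uminus_imag_units)
  qed
qed

text \<open>Serves to carry connectedness from the circular set to the closed upper half of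
  \<open>D\<close>.\<close>

lemma upper_proj_image_circular_set:
  assumes "\<forall>z\<in>D. cnj z \<in> D"
  shows "upper_proj ` circular_set D = D \<inter> {z. Im z \<ge> 0}"
proof
  show "upper_proj ` circular_set D \<subseteq> D \<inter> {z. Im z \<ge> 0}"
  proof (rule image_subsetI)
    fix x assume "x \<in> circular_set D"
    with assms obtain z J where "z \<in> D" "Im z \<ge> 0" "J \<in> imag_units" "x = slice_point z J"
      by (rule circular_set_upper_cases)
    then show "upper_proj x \<in> D \<inter> {z. Im z \<ge> 0}" by (simp add: upper_proj_slice_point)
  qed
next
  have J: "Quat 0 1 0 0 \<in> imag_units" by (simp add: imag_units_iff)
  show "D \<inter> {z. Im z \<ge> 0} \<subseteq> upper_proj ` circular_set D"
  proof
    fix z assume "z \<in> D \<inter> {z. Im z \<ge> 0}"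
    then have "slice_point z (Quat 0 1 0 0) \<in> circular_set D"
        "z = upper_proj (slice_point z (Quat 0 1 0 0))"
      using J by (auto simp: circular_set_def upper_proj_slice_point)
    then show "z \<in> upper_proj ` circular_set D" by blast
  qed
qed

text \<open>If \<open>D\<close> meets the real axis take \<open>S = D\<close>, and otherwise the open upper half of \<open>D\<close>.\<close>

lemma connected_open_superset_upper_half:
  assumes "open D" "\<forall>z\<in>D. cnj z \<in> D" "connected (D \<inter> {z. Im z \<ge> 0})"
  obtains S where "D \<inter> {z. Im z \<ge> 0} \<subseteq> S" "S \<subseteq> D" "open S" "connected S"
proof -
  let ?U = "D \<inter> {z. Im z \<ge> 0}"
  show ?thesis
  proof (cases "\<exists>z\<in>D. Im z = 0")
    case True
    then obtain r where r: "r \<in> D" "Im r = 0" by blast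
    have "cnj r = r" using r by (simp add: complex_eq_iff)
    \<comment> \<open>The real point \<open>r\<close> lies in both the upper half and its mirror
      image, so their union, which is \<open>D\<close>, is connected.\<close>
    then have "r \<in> ?U \<inter> cnj ` ?U" using r by (auto intro: image_eqI [of _ _ r])
    moreover have "connected (cnj ` ?U)"
      using assms(3) by (intro connected_continuous_image continuous_intros)
    ultimately have "connected (?U \<union> cnj ` ?U)"
      using assms(3) by (intro connected_Un) auto
    moreover have "?U \<union> cnj ` ?U = D"
    proof
      show "D \<subseteq> ?U \<union> cnj ` ?U"
      proof
        fix z assume "z \<in> D"
        then show "z \<in> ?U \<union> cnj ` ?U"
          using assms(2) by (cases "Im z \<ge> 0") (auto intro!: image_eqI [of z cnj "cnj z"])
      qed
    qed (use assms(2) in auto)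
    ultimately show ?thesis using that [of D] assms(1) by auto
  next
    case False
    then have "?U = D \<inter> {z. Im z > 0}" by force
    moreover have "open (D \<inter> {z. Im z > 0})"
      using assms(1) by (intro open_Int open_halfspace_Im_gt)
    ultimately show ?thesis using that [of ?U] assms(3) by auto
  qed
qed

text \<open>Continuity preserves the limit of a sequence in \<open>A - {p}\<close>; injectivity on
  one half slice keeps its image away from \<open>upper_proj p\<close>.\<close>

lemma islimpt_upper_proj_image:
  assumes J: "J \<in> imag_units" and A: "A \<subseteq> half_slice J" and p: "p \<in> A" "p islimpt A"
  shows "upper_proj p islimpt upper_proj ` A"
proof -
  have inj: "inj_on upper_proj (half_slice J)"
  proof (rule inj_onI)
    fix x y assume "x \<in> half_slice J" "y \<in> half_slice J" "upper_proj x = upper_proj y"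
    then show "x = y"
      using J by (auto simp: half_slice_def upper_proj_slice_point)
  qed
  obtain X where X: "\<And>n. X n \<in> A - {p}" "X \<longlonglongrightarrow> p"
    using p(2) by (auto simp: islimpt_sequential)
  have "isCont upper_proj p"
    using continuous_on_upper_proj [of UNIV] by (simp add: continuous_on_eq_continuous_at)
  then have "(\<lambda>n. upper_proj (X n)) \<longlonglongrightarrow> upper_proj p"
    using X(2) by (rule isCont_tendsto_compose)
  moreover have "upper_proj (X n) \<in> upper_proj ` A - {upper_proj p}" for n
    using X(1) [of n] inj A p(1) by (auto dest: inj_onD)
  ultimately show ?thesis
    unfolding islimpt_sequential by (intro exI [of _ "\<lambda>n. upper_proj (X n)"]) simp
qed

section \<open>Vanishing of the slice function on the whole circular set\<close>

theorem theorem21: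
  fixes D :: "complex set" and f :: "quat \<Rightarrow> quat"
  assumes "open D" and "\<forall>z\<in>D. cnj z \<in> D"
    and "open (circular_set D)" and "connected (circular_set D)"
    and "slice_regular D f"
    and "\<exists>J\<in>imag_units. \<exists>K\<in>imag_units. K \<noteq> J \<and>
      (\<exists>p \<in> half_slice_part D K \<inter> zero_locus D f.
         p islimpt (half_slice_part D K \<inter> zero_locus D f)) \<and>
      (\<exists>q \<in> half_slice_part D J \<inter> zero_locus D f.
         q islimpt (half_slice_part D J \<inter> zero_locus D f))"
  shows "\<forall>x\<in>circular_set D. f x = 0"
proof -
  let ?U = "D \<inter> {z. Im z \<ge> 0}"
  obtain F where F: "stem_function D F" "C1_stem D F" "\<forall>z\<in>D. dbar F z = 0"
    and f: "\<forall>x\<in>circular_set D. f x = induced_slice D F x"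
    using assms(5) by (auto simp: slice_regular_def)
  have f_eq: "f (slice_point z J) = fst (F z) + J * snd (F z)"
    if "z \<in> D" "J \<in> imag_units" for z J
  proof -
    have "slice_point z J \<in> circular_set D" using that by (auto simp: circular_set_def)
    then show ?thesis using f induced_slice_eq [OF F(1) that] by simp
  qed
  have "connected ?U"
    using connected_continuous_image [OF continuous_on_upper_proj assms(4)]
    by (simp add: upper_proj_image_circular_set [OF assms(2)])
  then obtain S where S: "?U \<subseteq> S" "S \<subseteq> D" "open S" "connected S"
    by (rule connected_open_superset_upper_half [OF assms(1,2)])
  have vanish: "fst (F z) + J * snd (F z) = 0"
    if J: "J \<in> imag_units" and p: "p \<in> half_slice_part D J \<inter> zero_locus D f"
      "p islimpt (half_slice_part D J \<inter> zero_locus D f)" and z: "z \<in> S" for J p z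
  proof -
    let ?A = "half_slice_part D J \<inter> zero_locus D f"
    \<comment> \<open>On the half slice of \<open>J\<close>, \<open>upper_proj\<close> inverts the
      parametrization \<open>w \<mapsto> slice_point w J\<close>, so zeros of \<open>f\<close>
      become zeros of \<open>fst (F w) + J * snd (F w)\<close>.\<close>
    have sub: "upper_proj ` ?A \<subseteq> {z \<in> S. fst (F z) + J * snd (F z) = 0}"
    proof clarify
      fix x assume x: "x \<in> half_slice_part D J" "x \<in> zero_locus D f"
      then obtain w where w: "x = slice_point w J" "Im w \<ge> 0"
        by (auto simp: half_slice_part_def half_slice_def)
      then have "w \<in> D"
        using x slice_point_in_circular_set_iff [OF assms(2) J] by (simp add: zero_locus_def)
      then show "upper_proj x \<in> S \<and> fst (F (upper_proj x)) + J * snd (F (upper_proj x)) = 0"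
        using w x J S(1) f_eq [OF _ J, of w]
        by (auto simp: upper_proj_slice_point zero_locus_def)
    qed
    have "?A \<subseteq> half_slice J" by (auto simp: half_slice_part_def)
    from islimpt_upper_proj_image [OF J this p]
    have "upper_proj p islimpt {z \<in> S. fst (F z) + J * snd (F z) = 0}"
      using sub by (rule islimpt_subset)
    moreover have "upper_proj p \<in> S" using sub p(1) by blast
    ultimately show ?thesis
      using stem_identity_theorem [OF J assms(1) F(2,3) S(2-4)] z by blast
  qed
  obtain J K where "J \<in> imag_units" "K \<in> imag_units" "K \<noteq> J"
    and "\<exists>p \<in> half_slice_part D K \<inter> zero_locus D f.
         p islimpt (half_slice_part D K \<inter> zero_locus D f)"
    and "\<exists>q \<in> half_slice_part D J \<inter> zero_locus D f.
         q islimpt (half_slice_part D J \<inter> zero_locus D f)"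
    using assms(6) by blast
  then have JK: "fst (F z) + J * snd (F z) = 0" "fst (F z) + K * snd (F z) = 0"
    if "z \<in> S" for z
    using that vanish by blast+
  have F0: "fst (F z) = 0 \<and> snd (F z) = 0" if "z \<in> S" for z
  proof -
    \<comment> \<open>Subtracting the two equations isolates \<open>snd (F z)\<close>; it vanishes
      because the quaternions have no zero divisors.\<close>
    have "(K - J) * snd (F z) = 0"
      using JK [OF that] by (simp add: left_diff_distrib add_eq_0_iff)
    then show ?thesis using \<open>K \<noteq> J\<close> JK [OF that] by simp
  qed
  show ?thesis
  proof
    fix x assume "x \<in> circular_set D"
    \<comment> \<open>Only parameters in the closed upper half are known to lie in \<open>S\<close>;
      each point has one, with some unit \<open>L\<close>.\<close>
    then obtain z L where "z \<in> D" "Im z \<ge> 0" "L \<in> imag_units" "x = slice_point z L"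
      by (rule circular_set_upper_cases [OF assms(2)])
    then show "f x = 0" using F0 [of z] S(1) by (auto simp: f_eq)
  qed
qed

end
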